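(* Let $f:\mathbb{R}^d\to\mathbb{R}$ be continuously differentiable and attain its minimum $f^\ast$, and let $(x_t)_{t\ge0}$ be a solution of the gradient flow $\dot x_t=-\nabla f(x_t)$. Let $\mu,L_0>0$ and $a\in(0,1]$. (i) If $f\in\mathrm{PL}^\mu$, then for all $t\ge0$, $$f(x_t)-f^\ast\le(f(x_0)-f^\ast)\,e^{-2\mu t}.$$ (ii) If $f$ has a unique global minimizer $x^\ast$ and $f\in\mathrm{PL}^\mu\cap\mathrm{AC}^a\cap\mathrm{QG}_+^{L_0}$, then for all $t\ge0$, $$f(x_t)-f^\ast\le\Big(1+\sqrt{\frac{L_0}{\mu_0}}\Big)(f(x_0)-f^\ast)\,e^{-a\sqrt{\mu\mu_0}\,t},$$ where $\mu_0:=\sup\{\mu'\ge\mu: f\in\mathrm{QG}_-^{\mu'}\}$.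
   Context: Function classes ($x^\ast$ is the global minimizer, $f^\ast=f(x^\ast)$): - $\mathrm{PL}^\mu$: $\|\nabla f(x)\|^2\ge2\mu(f(x)-f^\ast)$ for all $x$. - $\mathrm{AC}^a$: $\langle\nabla f(x),x-x^\ast\rangle\ge a\|\nabla f(x)\|\|x-x^\ast\|$ for all $x$. - $\mathrm{QG}_+^{L_0}$: $f(x)-f^\ast\le\frac{L_0}{2}\|x-x^\ast\|^2$ for all $x$. - $\mathrm{QG}_-^{\mu'}$: $f(x)-f^\ast\ge\frac{\mu'}{2}\|x-x^\ast\|^2$ for all $x$. Part (i) is a known result, recalled for comparison. *)

theory Defs
  imports "HOL-Analysis.Analysis"
begin

definition grad :: "(real ^ 'n \<Rightarrow> real) \<Rightarrow> real ^ 'n \<Rightarrow> real ^ 'n" where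
  "grad f x = (THE D. GDERIV f x :> D)"

lemma GDERIV_grad:
  assumes "f differentiable (at x)"
  shows "GDERIV f x :> grad f x"
proof -
  obtain f' where f': "(f has_derivative f') (at x)"
    using assms by (auto simp: differentiable_def)
  define D where "D = (\<Sum>b\<in>Basis. f' b *\<^sub>R b)"
  have lin: "linear f'"
    using f' by (rule has_derivative_linear)
  have f'_eq: "f' h = h \<bullet> D" for h
  proof -
    have "f' h = f' (\<Sum>b\<in>Basis. (h \<bullet> b) *\<^sub>R b)"
      by (simp add: euclidean_representation)
    also have "\<dots> = (\<Sum>b\<in>Basis. (h \<bullet> b) * f' b)"
      by (simp add: linear_sum[OF lin] linear_cmul[OF lin])
    also have "\<dots> = h \<bullet> D"
      by (simp add: D_def inner_sum_right mult.commute)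
    finally show ?thesis .
  qed
  then have D: "GDERIV f x :> D"
    using f' ext[of f' "\<lambda>h. h \<bullet> D", OF f'_eq] by (simp add: gderiv_def)
  have "E = D" if "GDERIV f x :> E" for E
  proof -
    have "(\<lambda>h. h \<bullet> E) = (\<lambda>h. h \<bullet> D)"
      using that D unfolding gderiv_def by (rule has_derivative_unique)
    then show ?thesis
      by (metis vector_eq_ldot)
  qed
  with D show ?thesis
    unfolding grad_def by (rule theI)
qed

definition continuously_differentiable :: "(real ^ 'n \<Rightarrow> real) \<Rightarrow> bool" where
  "continuously_differentiable f \<longleftrightarrow>
     (\<forall>x. f differentiable (at x)) \<and> continuous_on UNIV (grad f)"

definition global_minimizer :: "('a \<Rightarrow> real) \<Rightarrow> 'a \<Rightarrow> bool" where
  "global_minimizer f z \<longleftrightarrow> (\<forall>y. f z \<le> f y)"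

text \<open>The value \<open>f\<^sup>*\<close>. It is the minimum of \<open>f\<close> whenever \<open>f\<close> has a global minimizer.\<close>

definition min_value :: "('a \<Rightarrow> real) \<Rightarrow> real" where
  "min_value f = (INF y. f y)"

lemma min_value_eq: "global_minimizer f z \<Longrightarrow> min_value f = f z"
  unfolding global_minimizer_def min_value_def by (auto intro: cInf_eq_minimum)

definition PL :: "real \<Rightarrow> (real ^ 'n \<Rightarrow> real) set" where
  "PL \<mu> = {f. \<forall>x. (norm (grad f x))\<^sup>2 \<ge> 2 * \<mu> * (f x - min_value f)}"

text \<open>The remaining classes take the minimizer \<open>x\<^sup>*\<close>, written \<open>z\<close>, as a parameter.\<close>

definition AC :: "real \<Rightarrow> real ^ 'n \<Rightarrow> (real ^ 'n \<Rightarrow> real) set" where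
  "AC a z = {f. \<forall>x. grad f x \<bullet> (x - z) \<ge> a * norm (grad f x) * norm (x - z)}"

definition QG_upper :: "real \<Rightarrow> real ^ 'n \<Rightarrow> (real ^ 'n \<Rightarrow> real) set" where
  "QG_upper L z = {f. \<forall>x. f x - min_value f \<le> L / 2 * (norm (x - z))\<^sup>2}"

definition QG_lower :: "real \<Rightarrow> real ^ 'n \<Rightarrow> (real ^ 'n \<Rightarrow> real) set" where
  "QG_lower \<mu>' z = {f. \<forall>x. f x - min_value f \<ge> \<mu>' / 2 * (norm (x - z))\<^sup>2}"

text \<open>For \<open>f\<close> in \<open>PL \<mu>\<close> and \<open>QG_upper L z\<close> with unique global minimizer \<open>z\<close>, the set below
  contains \<open>\<mu>\<close> and is bounded above by \<open>L\<close>, so the real supremum is not a junk value.\<close>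

definition optimal_QG :: "real \<Rightarrow> real ^ 'n \<Rightarrow> (real ^ 'n \<Rightarrow> real) \<Rightarrow> real" where
  "optimal_QG \<mu> z f = Sup {\<mu>'. \<mu>' \<ge> \<mu> \<and> f \<in> QG_lower \<mu>' z}"

text \<open>At time \<open>0\<close> the derivative is one-sided.\<close>

definition gradient_flow :: "(real ^ 'n \<Rightarrow> real) \<Rightarrow> (real \<Rightarrow> real ^ 'n) \<Rightarrow> bool" where
  "gradient_flow f x \<longleftrightarrow>
     (\<forall>t\<ge>0. (x has_vector_derivative - grad f (x t)) (at t within {0..}))"

end

theory Submission
  imports Defs
begin

text \<open>
  Part (i) is Gronwall's inequality for \<open>f - f\<^sup>*\<close>. For part (ii), write \<open>\<delta> = f - f\<^sup>*\<close> and
  \<open>r = \<parallel>x - x\<^sup>*\<parallel>\<close>. The Lyapunov function is \<open>E = \<delta> + \<surd>(L\<^sub>0\<mu>\<^sub>0) r\<^sup>2 / 2\<close>. Along the flow,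
  \<open>E' \<le> - \<surd>(L\<^sub>0\<mu>\<^sub>0) a \<parallel>\<nabla>f\<parallel> r\<close>, and \<open>\<parallel>\<nabla>f\<parallel> r \<ge> \<surd>(2\<mu>\<delta>) r\<close> is bounded below both by
  \<open>\<surd>(\<mu>\<mu>\<^sub>0) r\<^sup>2\<close> (lower quadratic growth) and by \<open>2\<surd>(\<mu>/L\<^sub>0) \<delta>\<close> (upper quadratic growth).
  Averaging the two bounds gives \<open>E' \<le> - a\<surd>(\<mu>\<mu>\<^sub>0) E\<close>, and \<open>E \<le> (1 + \<surd>(L\<^sub>0/\<mu>\<^sub>0)) \<delta>\<close> at time \<open>0\<close>.

  That \<open>\<mu>\<^sub>0\<close> is a supremum over a nonempty set is the implication from PL to quadratic growth.
  As \<open>f\<close> is only continuously differentiable, it is obtained from a variational principle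
  of Ekeland type rather than by following a gradient flow to its limit.
\<close>

section \<open>Gronwall's inequality and derivatives along the flow\<close>

text \<open>Multiplying \<open>E\<close> by the integrating factor \<open>exp (k * t)\<close> gives
  a nonincreasing function. At time 0 only continuity is asked for, since the flow has just a
  one-sided derivative there.\<close>

lemma exponential_decay:
  fixes E E' :: "real \<Rightarrow> real"
  assumes "continuous_on {0..} E"
    and "\<And>t. t > 0 \<Longrightarrow> (E has_real_derivative E' t) (at t)"
    and "\<And>t. t > 0 \<Longrightarrow> E' t \<le> - k * E t"
    and "t \<ge> 0"
  shows "E t \<le> E 0 * exp (- k * t)"
proof -
  define G where "G s = E s * exp (k * s)" for s
  have "G t \<le> G 0"
  proof (rule DERIV_nonpos_imp_decreasing_open[OF \<open>t \<ge> 0\<close>])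
    fix s :: real assume s: "0 < s" "s < t"
    have "(G has_real_derivative (E' s + k * E s) * exp (k * s)) (at s)"
      unfolding G_def
      by (auto intro!: derivative_eq_intros assms(2) s simp: algebra_simps)
    moreover have "(E' s + k * E s) * exp (k * s) \<le> 0"
      using assms(3)[of s] s by (intro mult_nonpos_nonneg) auto
    ultimately show "\<exists>y. (G has_real_derivative y) (at s) \<and> y \<le> 0"
      by blast
  next
    show "continuous_on {0..t} G"
      unfolding G_def
      by (intro continuous_intros continuous_on_subset[OF assms(1)]) auto
  qed
  then have "E t * exp (k * t) * exp (- k * t) \<le> E 0 * exp (- k * t)"
    unfolding G_def by (intro mult_right_mono) auto
  then show ?thesis
    by (simp add: mult.assoc flip: exp_add)
qed

lemma gradient_flow_has_vector_derivative:
  assumes "gradient_flow f x" "t > 0"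
  shows "(x has_vector_derivative - grad f (x t)) (at t)"
proof -
  have "at t within {0..} = at t"
    using assms(2) by (intro at_within_interior) (auto simp: interior_real_atLeast)
  then show ?thesis
    using assms unfolding gradient_flow_def by (metis less_imp_le)
qed

lemma gradient_flow_continuous_on:
  assumes "gradient_flow f x"
  shows "continuous_on {0..} x"
  using assms unfolding gradient_flow_def continuous_on_eq_continuous_within
  by (auto intro: has_vector_derivative_continuous)

lemma gradient_flow_value_derivative:
  assumes "gradient_flow f x" "t > 0" "f differentiable (at (x t))"
  shows "((\<lambda>s. f (x s)) has_real_derivative - (norm (grad f (x t)))\<^sup>2) (at t)"
proof -
  have "(f has_derivative (\<lambda>h. h \<bullet> grad f (x t))) (at (x t))"
    using GDERIV_grad[OF assms(3)] unfolding gderiv_def .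
  with gradient_flow_has_vector_derivative[OF assms(1,2)]
  have "((\<lambda>s. f (x s)) has_derivative (\<lambda>h. (h *\<^sub>R - grad f (x t)) \<bullet> grad f (x t))) (at t)"
    unfolding has_vector_derivative_def by (rule has_derivative_compose)
  then show ?thesis
    unfolding has_field_derivative_def
    by (rule has_derivative_eq_rhs) (auto simp: power2_norm_eq_inner)
qed

lemma gradient_flow_distance_derivative:
  assumes "gradient_flow f x" "t > 0"
  shows "((\<lambda>s. (norm (x s - z))\<^sup>2) has_real_derivative - 2 * (grad f (x t) \<bullet> (x t - z))) (at t)"
proof -
  have "(x has_derivative (\<lambda>h. h *\<^sub>R - grad f (x t))) (at t)"
    using gradient_flow_has_vector_derivative[OF assms] unfolding has_vector_derivative_def .
  then have "((\<lambda>s. (x s - z) \<bullet> (x s - z)) has_derivative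
      (\<lambda>h. (x t - z) \<bullet> (h *\<^sub>R - grad f (x t) - 0) + (h *\<^sub>R - grad f (x t) - 0) \<bullet> (x t - z))) (at t)"
    by (intro has_derivative_inner has_derivative_diff has_derivative_const)
  then show ?thesis
    unfolding has_field_derivative_def power2_norm_eq_inner
    by (rule has_derivative_eq_rhs) (auto simp: inner_commute)
qed

section \<open>From PL to lower quadratic growth by a variational principle\<close>

text \<open>Minimise \<open>g y + c * dist x y\<close>. Outside the ball of radius
  \<open>g x / c\<close> the penalty alone exceeds \<open>g x\<close>, so a minimum over this
  compact ball is global. The triangle inequality then moves the centre of the penalty from
  \<open>x\<close> to \<open>y\<close>.\<close>

lemma ekeland_minimizer:
  fixes g :: "'a::{heine_borel} \<Rightarrow> real"
  assumes "continuous_on UNIV g" "\<And>y. g y \<ge> 0" "c > 0"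
  obtains y where "g y + c * dist x y \<le> g x" "\<And>w. g y \<le> g w + c * dist y w"
proof -
  define h where "h y = g y + c * dist x y" for y
  define R where "R = g x / c"
  have R: "R \<ge> 0"
    using assms by (simp add: R_def)
  have "continuous_on (cball x R) h"
    unfolding h_def by (intro continuous_intros continuous_on_subset[OF assms(1)]) auto
  then obtain y where y: "y \<in> cball x R" "\<And>w. w \<in> cball x R \<Longrightarrow> h y \<le> h w"
    using continuous_attains_inf[of "cball x R" h] R by auto
  have hy: "h y \<le> g x"
    using y(2)[of x] R by (simp add: h_def)
  have min: "h y \<le> h w" for w
  proof (cases "w \<in> cball x R")
    case False
    then have "g x \<le> c * dist x w"
      using assms(3) by (simp add: R_def field_simps)
    with hy assms(2)[of w] show ?thesis
      by (simp add: h_def)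
  qed (rule y(2))
  show ?thesis
  proof
    show "g y + c * dist x y \<le> g x"
      using hy by (simp add: h_def)
    show "g y \<le> g w + c * dist y w" for w
    proof -
      have "c * dist x w \<le> c * (dist x y + dist y w)"
        using assms(3) by (intro mult_left_mono dist_triangle) auto
      then show ?thesis
        using min[of w] by (simp add: h_def distrib_left)
    qed
  qed
qed

text \<open>The last hypothesis says that \<open>sqrt (f - m)\<close> descends from \<open>y\<close>
  with slope at most \<open>c\<close>, and its gradient at \<open>y\<close> is
  \<open>grad f y\<close> divided by \<open>2 * sqrt (f y - m)\<close>.\<close>

lemma norm_grad_le_of_sqrt_minorant:
  fixes f :: "real ^ 'n \<Rightarrow> real"
  assumes "f differentiable (at y)" "f y > m" "c \<ge> 0"
    and "\<And>w. sqrt (f y - m) \<le> sqrt (f w - m) + c * dist y w"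
  shows "norm (grad f y) \<le> 2 * c * sqrt (f y - m)"
proof (rule ccontr)
  define D where "D = grad f y"
  define q where "q = sqrt (f y - m)"
  \<comment> \<open>For \<open>s\<close> \<ge> 0, \<open>\<phi> s\<close> is the right side of the
    last hypothesis on the steepest descent ray, so \<open>\<phi> 0\<close> is least there. The
    signed \<open>s\<close> in the penalty makes \<open>\<phi>\<close> differentiable at 0, with
    derivative \<open>l\<close>, which is negative if the claim fails.\<close>
  define l where "l = - (norm D)\<^sup>2 / (2 * q) + c * norm D"
  define \<phi> where "\<phi> s = sqrt (f (y - s *\<^sub>R D) - m) + c * s * norm D" for s :: real
  assume "\<not> norm (grad f y) \<le> 2 * c * sqrt (f y - m)"
  then have big: "norm D > 2 * c * q"
    by (simp add: D_def q_def)
  have q: "q > 0"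
    using assms(2) by (simp add: q_def)
  have "D \<noteq> 0"
    using big mult_nonneg_nonneg[OF assms(3) less_imp_le[OF q]] by auto
  have "(f has_derivative (\<lambda>h. h \<bullet> D)) (at (y - 0 *\<^sub>R D))"
    using GDERIV_grad[OF assms(1)] unfolding gderiv_def D_def by simp
  moreover have "((\<lambda>s. y - s *\<^sub>R D) has_derivative (\<lambda>s. 0 - s *\<^sub>R D)) (at 0)"
    by (intro derivative_intros)
  ultimately have "((\<lambda>s. f (y - s *\<^sub>R D)) has_derivative (\<lambda>s. (0 - s *\<^sub>R D) \<bullet> D)) (at 0)"
    by (rule has_derivative_compose[rotated])
  then have "((\<lambda>s. f (y - s *\<^sub>R D)) has_real_derivative - (norm D)\<^sup>2) (at 0)"
    unfolding has_field_derivative_def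
    by (rule has_derivative_eq_rhs) (auto simp: power2_norm_eq_inner)
  then have "(\<phi> has_real_derivative l) (at 0)"
    unfolding \<phi>_def l_def q_def using assms(2)
    by (auto intro!: derivative_eq_intros simp: field_simps)
  moreover have "l < 0"
    unfolding l_def using big q \<open>D \<noteq> 0\<close> by (simp add: field_simps power2_eq_square)
  ultimately obtain d where "d > 0" and d: "\<And>h. 0 < h \<Longrightarrow> h < d \<Longrightarrow> \<phi> (0 + h) < \<phi> 0"
    using DERIV_neg_dec_right by blast
  then have "\<phi> (d / 2) < \<phi> 0"
    using d[of "d / 2"] by simp
  moreover have "\<phi> 0 \<le> \<phi> (d / 2)"
    using assms(4)[of "y - (d / 2) *\<^sub>R D"] \<open>d > 0\<close> by (simp add: \<phi>_def dist_norm)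
  ultimately show False
    by simp
qed

text \<open>PL says that \<open>sqrt (f - f z)\<close> has slope at least
  \<open>sqrt (\<mu> / 2)\<close> wherever it is positive. For a penalty of smaller slope the
  variational principle can therefore only stop at a minimizer, that is at \<open>z\<close>.\<close>

lemma PL_imp_QG_lower:
  assumes diff: "\<And>x. f differentiable (at x)"
    and min: "global_minimizer f z" and uniq: "\<And>y. global_minimizer f y \<Longrightarrow> y = z"
    and PL: "f \<in> PL \<mu>" and "\<mu> > 0"
  shows "f \<in> QG_lower \<mu> z"
proof -
  have ge: "f z \<le> f y" for y
    using min by (auto simp: global_minimizer_def)
  have m: "min_value f = f z"
    using min by (rule min_value_eq)
  have "\<mu> / 2 * (norm (x - z))\<^sup>2 \<le> f x - f z" for x
  proof -
    \<comment> \<open>The factor \<open>s < 1\<close> makes the contradiction with PL strict; it is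
      removed at the end by letting \<open>s\<close> tend to 1.\<close>
    have "s * (sqrt (\<mu> / 2) * dist x z) \<le> sqrt (f x - f z)" if s: "0 < s" "s < 1" for s
    proof -
      define c where "c = s * sqrt (\<mu> / 2)"
      have c: "c > 0"
        using s \<open>\<mu> > 0\<close> by (simp add: c_def)
      have "continuous_on UNIV (\<lambda>y. sqrt (f y - f z))"
        by (intro continuous_intros differentiable_imp_continuous_on differentiable_at_imp_differentiable_on diff)
      then obtain y where y: "sqrt (f y - f z) + c * dist x y \<le> sqrt (f x - f z)"
          "\<And>w. sqrt (f y - f z) \<le> sqrt (f w - f z) + c * dist y w"
        using ekeland_minimizer[of "\<lambda>y. sqrt (f y - f z)" c x] ge c by auto
      have "f y \<le> f z"
      proof (rule ccontr)
        assume "\<not> f y \<le> f z"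
        then have pos: "f y - f z > 0"
          by simp
        have "norm (grad f y) \<le> 2 * c * sqrt (f y - f z)"
          using y(2) pos c by (intro norm_grad_le_of_sqrt_minorant diff) auto
        then have "(norm (grad f y))\<^sup>2 \<le> (2 * c * sqrt (f y - f z))\<^sup>2"
          by (rule power_mono) simp
        also have "\<dots> = s\<^sup>2 * (2 * \<mu> * (f y - f z))"
          using pos \<open>\<mu> > 0\<close> by (simp add: c_def power_mult_distrib)
        also have "\<dots> < 1 * (2 * \<mu> * (f y - f z))"
          using pos \<open>\<mu> > 0\<close> s by (intro mult_strict_right_mono) (auto simp: power_less_one_iff)
        finally show False
          using PL by (auto simp: PL_def m not_less[symmetric])
      qed
      then have "global_minimizer f y"
        using ge unfolding global_minimizer_def by (meson order_trans)
      then show ?thesis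
        using y(1) uniq[of y] by (simp add: c_def mult.assoc)
    qed
    then have "sqrt (\<mu> / 2) * dist x z \<le> sqrt (f x - f z)"
      by (rule field_le_mult_one_interval)
    then have "(sqrt (\<mu> / 2) * dist x z)\<^sup>2 \<le> (sqrt (f x - f z))\<^sup>2"
      by (rule power_mono) (use \<open>\<mu> > 0\<close> in simp)
    then show ?thesis
      using ge[of x] \<open>\<mu> > 0\<close> by (simp add: power_mult_distrib dist_norm)
  qed
  then show ?thesis
    by (simp add: QG_lower_def m)
qed

section \<open>The optimal lower growth constant\<close>

text \<open>At each point other than \<open>z\<close>, lower growth is an upper bound on the
  constant, and such bounds pass to the supremum. Upper growth makes the supremum finite.\<close>

lemma optimal_QG_bounds:
  fixes f :: "real ^ 'n \<Rightarrow> real"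
  assumes "f \<in> QG_lower \<mu> z" "f \<in> QG_upper L z"
  shows "\<mu> \<le> optimal_QG \<mu> z f" "f \<in> QG_lower (optimal_QG \<mu> z f) z"
proof -
  define S where "S = {\<mu>'. \<mu>' \<ge> \<mu> \<and> f \<in> QG_lower \<mu>' z}"
  have opt: "optimal_QG \<mu> z f = Sup S"
    by (simp add: optimal_QG_def S_def)
  have \<mu>: "\<mu> \<in> S"
    using assms(1) by (simp add: S_def)
  \<comment> \<open>At distance 1 the two growth bounds compare the constants directly.\<close>
  obtain y where y: "dist z y = 1"
    using vector_choose_dist[of 1 z] by auto
  have "\<mu>' \<le> L" if "\<mu>' \<in> S" for \<mu>'
  proof -
    have "\<mu>' / 2 * (norm (y - z))\<^sup>2 \<le> f y - min_value f"
      using that by (auto simp: S_def QG_lower_def)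
    also have "\<dots> \<le> L / 2 * (norm (y - z))\<^sup>2"
      using assms(2) by (auto simp: QG_upper_def)
    finally show ?thesis
      using y by (simp add: dist_norm norm_minus_commute)
  qed
  then have "bdd_above S"
    by (rule bdd_aboveI)
  then show "\<mu> \<le> optimal_QG \<mu> z f"
    unfolding opt using \<mu> by (rule cSup_upper[rotated])
  have "Sup S / 2 * (norm (x - z))\<^sup>2 \<le> f x - min_value f" for x
  proof (cases "x = z")
    case True
    then show ?thesis
      using assms(1) by (auto simp: QG_lower_def dest: spec[of _ z])
  next
    case False
    have "Sup S \<le> 2 * (f x - min_value f) / (norm (x - z))\<^sup>2"
    proof (rule cSup_least)
      show "S \<noteq> {}"
        using \<mu> by auto
      fix \<mu>' assume "\<mu>' \<in> S"
      then have "\<mu>' / 2 * (norm (x - z))\<^sup>2 \<le> f x - min_value f"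
        by (auto simp: S_def QG_lower_def)
      then show "\<mu>' \<le> 2 * (f x - min_value f) / (norm (x - z))\<^sup>2"
        using False by (simp add: pos_le_divide_eq)
    qed
    then show ?thesis
      using False by (simp add: pos_le_divide_eq)
  qed
  then show "f \<in> QG_lower (optimal_QG \<mu> z f) z"
    by (simp add: QG_lower_def opt)
qed

section \<open>Lyapunov estimate and decay rates\<close>

text \<open>Here \<open>g\<close> stands for the norm of the gradient and \<open>p\<close> for its
  inner product with \<open>x - z\<close>; the left side is the derivative of the Lyapunov function
  along the flow.\<close>

lemma lyapunov_derivative_bound:
  fixes a \<mu> \<mu>\<^sub>0 L \<delta> r g p :: real
  assumes "a \<ge> 0" "\<mu> \<ge> 0" "\<mu>\<^sub>0 \<ge> 0" "L > 0" "\<delta> \<ge> 0" "r \<ge> 0" "g \<ge> 0"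
    and PL: "2 * \<mu> * \<delta> \<le> g\<^sup>2"
    and AC: "a * g * r \<le> p"
    and upper: "\<delta> \<le> L / 2 * r\<^sup>2"
    and lower: "\<mu>\<^sub>0 / 2 * r\<^sup>2 \<le> \<delta>"
  shows "- g\<^sup>2 - sqrt (L * \<mu>\<^sub>0) * p \<le> - (a * sqrt (\<mu> * \<mu>\<^sub>0)) * (\<delta> + sqrt (L * \<mu>\<^sub>0) / 2 * r\<^sup>2)"
proof -
  have g: "sqrt (2 * \<mu> * \<delta>) \<le> g"
    using real_sqrt_le_mono[OF PL] assms by simp
  have "sqrt (\<mu> * \<mu>\<^sub>0) * r \<le> sqrt (2 * \<mu> * \<delta>)"
  proof (rule real_le_rsqrt)
    have "\<mu> * (\<mu>\<^sub>0 * r\<^sup>2) \<le> \<mu> * (2 * \<delta>)"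
      using lower assms by (intro mult_left_mono) auto
    then show "(sqrt (\<mu> * \<mu>\<^sub>0) * r)\<^sup>2 \<le> 2 * \<mu> * \<delta>"
      using assms by (simp add: power_mult_distrib mult_ac)
  qed
  then have "sqrt (\<mu> * \<mu>\<^sub>0) * r * r \<le> g * r"
    using g assms by (intro mult_right_mono) auto
  then have "a * sqrt (L * \<mu>\<^sub>0) * (sqrt (\<mu> * \<mu>\<^sub>0) * r\<^sup>2) \<le> a * sqrt (L * \<mu>\<^sub>0) * (g * r)"
    using assms by (intro mult_left_mono) (auto simp: power2_eq_square mult_ac)
  moreover have "a * (sqrt (\<mu> * \<mu>\<^sub>0) * (2 * \<delta>)) \<le> a * (sqrt (L * \<mu>\<^sub>0) * (g * r))"
  proof -
    have r: "sqrt (2 * \<delta>) \<le> sqrt L * r"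
      using upper assms by (intro real_le_lsqrt) (auto simp: power_mult_distrib)
    \<comment> \<open>The factors are split so that PL bounds
      \<open>sqrt (2 * \<mu> * \<delta>)\<close> and upper growth bounds
      \<open>sqrt (2 * \<delta>)\<close>.\<close>
    have "sqrt (\<mu> * \<mu>\<^sub>0) * (2 * \<delta>) = sqrt \<mu>\<^sub>0 * (sqrt (2 * \<mu> * \<delta>) * sqrt (2 * \<delta>))"
      using assms real_sqrt_mult[of \<mu> "2 * \<delta>"]
      by (simp add: real_sqrt_mult[of \<mu> \<mu>\<^sub>0] mult.left_commute[of _ \<mu>] mult.assoc)
    also have "\<dots> \<le> sqrt \<mu>\<^sub>0 * (g * (sqrt L * r))"
      using g r assms by (intro mult_left_mono mult_mono) auto
    finally show ?thesis
      using assms by (intro mult_left_mono) (auto simp: real_sqrt_mult mult_ac)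
  qed
  moreover have "sqrt (L * \<mu>\<^sub>0) * (a * g * r) \<le> sqrt (L * \<mu>\<^sub>0) * p"
    using AC assms by (intro mult_left_mono) auto
  \<comment> \<open>Half the sum of the first two bounds, followed by the angle condition.\<close>
  ultimately have "a * sqrt (\<mu> * \<mu>\<^sub>0) * (\<delta> + sqrt (L * \<mu>\<^sub>0) / 2 * r\<^sup>2) \<le> sqrt (L * \<mu>\<^sub>0) * p"
    by (simp add: algebra_simps)
  then show ?thesis
    using zero_le_power2[of g] unfolding mult_minus_left by linarith
qed

lemma gradient_flow_PL_decay:
  assumes "\<And>y. f differentiable (at y)" "gradient_flow f x" "f \<in> PL \<mu>" "t \<ge> 0"
  shows "f (x t) - min_value f \<le> (f (x 0) - min_value f) * exp (- (2 * \<mu>) * t)"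
proof (rule exponential_decay[OF _ _ _ \<open>t \<ge> 0\<close>])
  have "continuous_on UNIV f"
    by (intro differentiable_imp_continuous_on differentiable_at_imp_differentiable_on assms(1))
  then show "continuous_on {0..} (\<lambda>s. f (x s) - min_value f)"
    by (intro continuous_intros continuous_on_compose2[OF _ gradient_flow_continuous_on[OF assms(2)]]) auto
next
  fix s :: real assume "s > 0"
  show "((\<lambda>s. f (x s) - min_value f) has_real_derivative - (norm (grad f (x s)))\<^sup>2) (at s)"
    using DERIV_diff[OF gradient_flow_value_derivative[OF assms(2) \<open>s > 0\<close> assms(1)] DERIV_const] by simp
  show "- (norm (grad f (x s)))\<^sup>2 \<le> - (2 * \<mu>) * (f (x s) - min_value f)"
    using assms(3) by (auto simp: PL_def)
qed

text \<open>Any positive lower growth constant is allowed, which keeps the supremum out of the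
  dynamics.\<close>

lemma gradient_flow_QG_decay:
  fixes f :: "real ^ 'n \<Rightarrow> real"
  assumes diff: "\<And>y. f differentiable (at y)" and flow: "gradient_flow f x"
    and min: "global_minimizer f z"
    and classes: "f \<in> PL \<mu>" "f \<in> AC a z" "f \<in> QG_upper L z" "f \<in> QG_lower \<mu>\<^sub>0 z"
    and pos: "\<mu> \<ge> 0" "\<mu>\<^sub>0 > 0" "L > 0" "a \<ge> 0" and "t \<ge> 0"
  shows "f (x t) - min_value f
    \<le> (1 + sqrt (L / \<mu>\<^sub>0)) * (f (x 0) - min_value f) * exp (- (a * sqrt (\<mu> * \<mu>\<^sub>0)) * t)"
proof -
  define c where "c = sqrt (L * \<mu>\<^sub>0)"
  define E where "E s = (f (x s) - min_value f) + c / 2 * (norm (x s - z))\<^sup>2" for s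
  have c: "c \<ge> 0"
    using pos by (simp add: c_def)
  have ge: "f y - min_value f \<ge> 0" for y
    using min min_value_eq[OF min] by (simp add: global_minimizer_def)
  have contf: "continuous_on UNIV f"
    by (intro differentiable_imp_continuous_on differentiable_at_imp_differentiable_on diff)
  have "E t \<le> E 0 * exp (- (a * sqrt (\<mu> * \<mu>\<^sub>0)) * t)"
  proof (rule exponential_decay[OF _ _ _ \<open>t \<ge> 0\<close>])
    show "continuous_on {0..} E"
      unfolding E_def
      by (intro continuous_intros gradient_flow_continuous_on[OF flow]
          continuous_on_compose2[OF contf gradient_flow_continuous_on[OF flow]]) auto
  next
    fix s :: real assume "s > 0"
    show "(E has_real_derivative
        - (norm (grad f (x s)))\<^sup>2 - c * (grad f (x s) \<bullet> (x s - z))) (at s)"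
      unfolding E_def
      by (rule derivative_eq_intros refl gradient_flow_value_derivative[OF flow \<open>s > 0\<close> diff]
          gradient_flow_distance_derivative[OF flow \<open>s > 0\<close>])+ simp
    show "- (norm (grad f (x s)))\<^sup>2 - c * (grad f (x s) \<bullet> (x s - z)) \<le> - (a * sqrt (\<mu> * \<mu>\<^sub>0)) * E s"
      unfolding E_def c_def using pos ge classes
      by (intro lyapunov_derivative_bound) (auto simp: PL_def AC_def QG_upper_def QG_lower_def)
  qed
  also have "E 0 \<le> (1 + sqrt (L / \<mu>\<^sub>0)) * (f (x 0) - min_value f)"
  proof -
    \<comment> \<open>This form of the weight lets lower growth bound the distance term at time 0 by
      \<open>sqrt (L / \<mu>\<^sub>0)\<close> times the initial gap.\<close>
    have "c = sqrt (L / \<mu>\<^sub>0) * \<mu>\<^sub>0"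
      using pos unfolding c_def real_sqrt_mult real_sqrt_divide by (simp add: field_simps)
    then have "c / 2 * (norm (x 0 - z))\<^sup>2 = sqrt (L / \<mu>\<^sub>0) * (\<mu>\<^sub>0 / 2 * (norm (x 0 - z))\<^sup>2)"
      by simp
    also have "\<dots> \<le> sqrt (L / \<mu>\<^sub>0) * (f (x 0) - min_value f)"
      using classes(4) pos by (intro mult_left_mono) (auto simp: QG_lower_def)
    finally show ?thesis
      by (simp add: E_def distrib_right)
  qed
  finally have "E t \<le> (1 + sqrt (L / \<mu>\<^sub>0)) * (f (x 0) - min_value f) * exp (- (a * sqrt (\<mu> * \<mu>\<^sub>0)) * t)"
    by simp
  moreover have "f (x t) - min_value f \<le> E t"
    using c by (simp add: E_def)
  ultimately show ?thesis
    by simp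
qed

theorem theorem5p1:
  fixes f :: "real ^ 'n \<Rightarrow> real" and x :: "real \<Rightarrow> real ^ 'n"
    and \<mu> L\<^sub>0 a :: real
  assumes "continuously_differentiable f"
    and "\<exists>z. global_minimizer f z"
    and "gradient_flow f x"
    and "\<mu> > 0" and "L\<^sub>0 > 0" and "0 < a" and "a \<le> 1"
  shows "(f \<in> PL \<mu> \<longrightarrow>
           (\<forall>t\<ge>0. f (x t) - min_value f \<le> (f (x 0) - min_value f) * exp (- 2 * \<mu> * t)))
       \<and> (\<forall>z. global_minimizer f z \<and> (\<forall>y. global_minimizer f y \<longrightarrow> y = z)
              \<and> f \<in> PL \<mu> \<inter> AC a z \<inter> QG_upper L\<^sub>0 z \<longrightarrow>
           (let \<mu>\<^sub>0 = optimal_QG \<mu> z f in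
            \<forall>t\<ge>0. f (x t) - min_value f
              \<le> (1 + sqrt (L\<^sub>0 / \<mu>\<^sub>0)) * (f (x 0) - min_value f) * exp (- a * sqrt (\<mu> * \<mu>\<^sub>0) * t)))"
proof (intro conjI impI allI)
  have diff: "f differentiable (at y)" for y
    using assms(1) by (auto simp: continuously_differentiable_def)
  show "f (x t) - min_value f \<le> (f (x 0) - min_value f) * exp (- 2 * \<mu> * t)"
    if "f \<in> PL \<mu>" "t \<ge> 0" for t
    using gradient_flow_PL_decay[OF diff assms(3) that] by simp
  fix z
  assume z: "global_minimizer f z \<and> (\<forall>y. global_minimizer f y \<longrightarrow> y = z)
    \<and> f \<in> PL \<mu> \<inter> AC a z \<inter> QG_upper L\<^sub>0 z"
  then have "f \<in> QG_lower \<mu> z"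
    using \<open>\<mu> > 0\<close> by (intro PL_imp_QG_lower diff) auto
  \<comment> \<open>The supremum is itself a growth constant and is at least \<open>\<mu>\<close>,
    hence positive, so it can serve as the constant in the decay estimate.\<close>
  note opt = optimal_QG_bounds[OF this, of L\<^sub>0]
  show "let \<mu>\<^sub>0 = optimal_QG \<mu> z f in \<forall>t\<ge>0. f (x t) - min_value f
      \<le> (1 + sqrt (L\<^sub>0 / \<mu>\<^sub>0)) * (f (x 0) - min_value f) * exp (- a * sqrt (\<mu> * \<mu>\<^sub>0) * t)"
    unfolding Let_def
  proof (intro allI impI)
    fix t :: real assume "t \<ge> 0"
    have "optimal_QG \<mu> z f > 0"
      using opt(1) z \<open>\<mu> > 0\<close> by (meson IntD2 less_le_trans)
    then show "f (x t) - min_value f \<le> (1 + sqrt (L\<^sub>0 / optimal_QG \<mu> z f))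
        * (f (x 0) - min_value f) * exp (- a * sqrt (\<mu> * optimal_QG \<mu> z f) * t)"
      unfolding mult_minus_left[of a]
      using z opt(2) assms(4-6) \<open>t \<ge> 0\<close> by (intro gradient_flow_QG_decay[OF diff assms(3)]) auto
  qed
qed

end
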